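(* Let $q$ be a prime power, let $k \ge 3$ and $s$ be integers with $0 < s < q-2$ and $(s+2)\mid q$, and let $\mathcal{G}$ be an A$^s$MDS $[n,k,d]_q$ code, regarded as a projective $[n,k,d]_q$ system in $\mathrm{PG}(k-1,q)$, with $n = (s+1)(q+1)+k-3$. Then $\mathcal{G}$ can be uniquely extended to a length-maximal A$^s$MDS code; that is, there is exactly one point $X$ of $\mathrm{PG}(k-1,q)$ such that the multiset obtained from $\mathcal{G}$ by adding $X$ (with multiplicity one) is a projective system of an A$^s$MDS code of dimension $k$ and length $n+1 = (s+1)(q+1)+k-2$.
   Context: A linear $[n,k,d]_q$ code is a $k$-dimensional subspace of $\mathbb{F}_q^n$ with minimum distance $d \ge 1$. Codes are identified with projective systems: the columns of a generator matrix of a non-degenerate code (no coordinate identically zero on all codewords) form a multiset $\mathcal{G}$ of $n$ points of $\mathrm{PG}(k-1,q)$, the projective space of dimension $k-1$ over $\mathbb{F}_q$. A projective $[n,k,d]_q$ system is a multiset $\mathcal{G}$ of $n$ points (counted with multiplicity) of $\mathrm{PG}(k-1,q)$, not contained in a hyperplane, such that $n-d = \max\{|\mathcal{G}\cap H| : H \text{ a hyperplane of } \mathrm{PG}(k-1,q)\}$, where points of intersection are counted with multiplicity. The Singleton defect of an $[n,k,d]_q$ code is $n-k+1-d$, and the code is called A$^s$MDS if its Singleton defect equals $s \ge 0$. An A$^s$MDS $[n,k,d]_q$ code with $k\ge 3$ satisfies $n \le (s+1)(q+1)+k-2$, and it is called length-maximal if equality holds. *)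

theory Defs
  imports "HOL-Analysis.Cartesian_Space" "HOL-Library.Multiset"
begin

text \<open>
  \<^typ>\<open>'a\<close> is a finite field of order \<open>CARD('a)\<close>; the points and hyperplanes of the
  projective space over it of dimension \<open>CARD('k) - 1\<close> are the linear subspaces of
  \<open>'a ^ 'k\<close> of dimension 1 and codimension 1, and incidence is inclusion.
\<close>

definition pg_point :: "('a::{field,finite} ^ 'k::finite) set \<Rightarrow> bool" where
  "pg_point P \<longleftrightarrow> vec.subspace P \<and> vec.dim P = 1"

definition pg_hyperplane :: "('a::{field,finite} ^ 'k::finite) set \<Rightarrow> bool" where
  "pg_hyperplane H \<longleftrightarrow> vec.subspace H \<and> vec.dim H = CARD('k) - 1"

definition meet_card ::
  "('a::{field,finite} ^ 'k::finite) set multiset \<Rightarrow> ('a ^ 'k) set \<Rightarrow> nat" where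
  "meet_card G H = size (filter_mset (\<lambda>P. P \<subseteq> H) G)"

definition projective_system ::
  "nat \<Rightarrow> nat \<Rightarrow> nat \<Rightarrow> ('a::{field,finite} ^ 'k::finite) set multiset \<Rightarrow> bool" where
  "projective_system n k d G \<longleftrightarrow>
     k = CARD('k) \<and> size G = n \<and> (\<forall>P\<in>#G. pg_point P) \<and>
     \<not> (\<exists>H. pg_hyperplane H \<and> (\<forall>P\<in>#G. P \<subseteq> H)) \<and>
     int n - int d = int (Max {meet_card G H | H. pg_hyperplane H})"

definition singleton_defect :: "nat \<Rightarrow> nat \<Rightarrow> nat \<Rightarrow> int" where
  "singleton_defect n k d = int n - int k + 1 - int d"

text \<open>Non-degenerate linear codes are identified with their projective systems.\<close>

definition AsMDS ::
  "nat \<Rightarrow> nat \<Rightarrow> nat \<Rightarrow> nat \<Rightarrow> ('a::{field,finite} ^ 'k::finite) set multiset \<Rightarrow> bool" where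
  "AsMDS s n k d G \<longleftrightarrow> projective_system n k d G \<and> singleton_defect n k d = int s"

definition length_maximal_AsMDS ::
  "nat \<Rightarrow> nat \<Rightarrow> nat \<Rightarrow> nat \<Rightarrow> ('a::{field,finite} ^ 'k::finite) set multiset \<Rightarrow> bool" where
  "length_maximal_AsMDS s n k d G \<longleftrightarrow>
     k \<ge> 3 \<and> AsMDS s n k d G \<and> n = (s + 1) * (CARD('a) + 1) + k - 2"

end

theory Submission imports Defs begin

text \<open>
  Counting the system on the hyperplanes through a subspace of codimension 2 shows that any
  \<open>k - 1\<close> points of \<open>G\<close> are independent, and that among the hyperplanes through \<open>k - 2\<close> points of
  \<open>G\<close> exactly one is tangent, i.e. carries one point less than the maximum \<open>k - 1 + s\<close>.
  For a set \<open>A\<close> of points of \<open>G\<close> let \<open>Q A\<close> be the intersection of the tangent hyperplanes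
  containing \<open>A\<close>. Then \<open>Q A\<close> has dimension \<open>card A + 1\<close> whenever \<open>card A \<le> k - 2\<close>, and \<open>Q {}\<close> is
  the point to be added. For \<open>card A = k - 3\<close> the divisibility \<open>s + 2 dvd q\<close> forces the \<open>q + 1\<close>
  tangent hyperplanes through \<open>A\<close> to cover every codimension-2 subspace through \<open>A\<close>, and a
  covering of a plane by \<open>q + 1\<close> lines is a pencil. For smaller \<open>A\<close>, modulo the span of \<open>A\<close>, the
  subspaces \<open>Q (insert P A)\<close> are pairwise intersecting lines that are not all coplanar, hence
  concurrent.
\<close>

section \<open>Subspaces over a finite field\<close>

lemma two_le_card_field: "2 \<le> CARD('a::{field,finite})"
proof -
  have "card {0, 1::'a} \<le> CARD('a)"
    by (rule card_mono) auto
  then show ?thesis by simp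
qed

lemma card_span_insert:
  fixes b :: "'a::{field,finite} ^ 'k::finite"
  assumes "b \<notin> vec.span B"
  shows "card (vec.span (insert b B)) = CARD('a) * card (vec.span B)"
proof -
  have "bij_betw (\<lambda>(c, v). c *s b + v) (UNIV \<times> vec.span B) (vec.span (insert b B))"
    unfolding bij_betw_def
  proof
    show "inj_on (\<lambda>(c, v). c *s b + v) (UNIV \<times> vec.span B)"
    proof (rule inj_onI, clarsimp)
      fix c c' v v'
      assume v: "v \<in> vec.span B" "v' \<in> vec.span B" and eq: "c *s b + v = c' *s b + v'"
      have "(c - c') *s b = (c *s b + v) - c' *s b - v"
        by (simp add: vec.scale_left_diff_distrib)
      also have "\<dots> = v' - v"
        unfolding eq by simp
      finally have "(c - c') *s b = v' - v" .
      then have "(c - c') *s b \<in> vec.span B"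
        using v by (simp add: vec.span_diff)
      have "c = c'"
      proof (rule ccontr)
        assume "c \<noteq> c'"
        then have "inverse (c - c') * (c - c') = 1" by simp
        moreover have "inverse (c - c') *s ((c - c') *s b) \<in> vec.span B"
          using \<open>(c - c') *s b \<in> vec.span B\<close> by (rule vec.span_scale)
        ultimately have "b \<in> vec.span B"
          by (simp only: vector_smult_assoc vector_smult_lid)
        with assms show False ..
      qed
      then show "c = c' \<and> v = v'" using eq by simp
    qed
    show "(\<lambda>(c, v). c *s b + v) ` (UNIV \<times> vec.span B) = vec.span (insert b B)"
    proof (intro set_eqI iffI)
      fix x assume "x \<in> (\<lambda>(c, v). c *s b + v) ` (UNIV \<times> vec.span B)"
      then show "x \<in> vec.span (insert b B)"
      proof clarify
        fix c v assume "v \<in> vec.span B"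
        then have "c *s b + v - c *s b \<in> vec.span B" by simp
        then show "c *s b + v \<in> vec.span (insert b B)"
          unfolding vec.span_breakdown_eq by blast
      qed
    next
      fix x assume "x \<in> vec.span (insert b B)"
      then obtain c where "x - c *s b \<in> vec.span B"
        by (auto simp: vec.span_breakdown_eq)
      then show "x \<in> (\<lambda>(c, v). c *s b + v) ` (UNIV \<times> vec.span B)"
        by (intro image_eqI[where x="(c, x - c *s b)"]) auto
    qed
  qed
  then have "card ((UNIV :: 'a set) \<times> vec.span B) = card (vec.span (insert b B))"
    by (rule bij_betw_same_card)
  then show ?thesis by (simp add: card_cartesian_product)
qed

lemma card_subspace:
  fixes S :: "('a::{field,finite} ^ 'k::finite) set"
  assumes "vec.subspace S"
  shows "card S = CARD('a) ^ vec.dim S"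
proof -
  obtain B where B: "B \<subseteq> S" "vec.independent B" "S \<subseteq> vec.span B" "card B = vec.dim S"
    using vec.basis_exists by blast
  have "card (vec.span C) = CARD('a) ^ card C"
    if "finite C" "vec.independent C" for C :: "('a ^ 'k) set"
    using that
  proof (induction C)
    case empty
    then show ?case by simp
  next
    case (insert b C)
    then show ?case
      by (simp add: vec.independent_insert card_span_insert)
  qed
  moreover have "vec.span B = S"
    using B assms by (simp add: vec.span_subspace)
  ultimately show ?thesis
    using B finite[of B] by metis
qed

lemma dim_insert_subspace:
  fixes U :: "('a::field ^ 'k::finite) set"
  assumes "vec.subspace U" "x \<notin> U"
  shows "vec.dim (insert x U) = vec.dim U + 1"
  using assms by (simp add: vec.dim_insert vec.span_eq_iff[THEN iffD2])

text \<open>Any \<open>w\<close> in \<open>W\<close> outside \<open>V\<close> generates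
  \<open>E\<close> together with \<open>V\<close>. Subtracting from a vector of \<open>W\<close> a
  suitable multiple of \<open>w\<close> lands in \<open>V\<close> without leaving \<open>W\<close>,
  so \<open>w\<close> and the intersection generate \<open>W\<close>.\<close>

lemma dim_Int_hyperplane:
  fixes E V W :: "('a::field ^ 'k::finite) set"
  assumes "vec.subspace E" "vec.subspace V" "vec.subspace W" "V \<subseteq> E" "W \<subseteq> E"
    and "vec.dim E = vec.dim V + 1" "\<not> W \<subseteq> V"
  shows "vec.dim W = vec.dim (V \<inter> W) + 1"
proof -
  obtain w where w: "w \<in> W" "w \<notin> V" using assms by blast
  have "vec.dim (vec.span (insert w V)) = vec.dim E"
    using assms(2,6) w by (simp add: dim_insert_subspace)
  moreover have "vec.span (insert w V) \<subseteq> E"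
    using assms w by (intro vec.span_minimal) auto
  ultimately have E: "vec.span (insert w V) = E"
    using assms by (intro vec.subspace_dim_equal) auto
  have sVW: "vec.subspace (V \<inter> W)" using assms by (simp add: vec.subspace_inter)
  have "W \<subseteq> vec.span (insert w (V \<inter> W))"
  proof
    fix x assume "x \<in> W"
    then have "x \<in> vec.span (insert w V)" using E assms by blast
    then obtain c where c: "x - c *s w \<in> V"
      using assms by (auto simp: vec.span_breakdown_eq vec.span_eq_iff[THEN iffD2])
    have "x - c *s w \<in> W"
      using \<open>x \<in> W\<close> w assms by (simp add: vec.subspace_diff vec.subspace_scale)
    with c show "x \<in> vec.span (insert w (V \<inter> W))"
      by (auto simp: vec.span_breakdown_eq intro!: exI[of _ c] vec.span_base)
  qed
  moreover have "vec.span (insert w (V \<inter> W)) \<subseteq> W"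
    using assms w by (intro vec.span_minimal) auto
  ultimately have "vec.span (insert w (V \<inter> W)) = W" by blast
  then show ?thesis
    using dim_insert_subspace[OF sVW, of w] w vec.dim_span[of "insert w (V \<inter> W)"] by simp
qed

text \<open>These are the points of the projective space of the quotient \<open>V / U\<close>. For
  \<open>U\<close> of codimension 2 in the whole space they form the pencil of hyperplanes through
  \<open>U\<close>.\<close>

definition between ::
  "('a::{field,finite} ^ 'k::finite) set \<Rightarrow> ('a ^ 'k) set \<Rightarrow> ('a ^ 'k) set set" where
  "between U V = {W. vec.subspace W \<and> U \<subseteq> W \<and> W \<subseteq> V \<and> vec.dim W = vec.dim U + 1}"

lemma between_unique:
  assumes "vec.subspace U" "vec.subspace V" "U \<subseteq> V" "v \<in> V" "v \<notin> U"
  shows "W \<in> between U V \<and> v \<in> W \<longleftrightarrow> W = vec.span (insert v U)"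
proof
  assume W: "W \<in> between U V \<and> v \<in> W"
  then have "vec.span (insert v U) \<subseteq> W"
    by (intro vec.span_minimal) (auto simp: between_def)
  then show "W = vec.span (insert v U)"
    using W assms dim_insert_subspace[of U v]
    by (intro vec.subspace_dim_equal[symmetric]) (auto simp: between_def)
next
  assume W: "W = vec.span (insert v U)"
  have "vec.span (insert v U) \<subseteq> V"
    using assms by (intro vec.span_minimal) auto
  then show "W \<in> between U V \<and> v \<in> W"
    using W assms dim_insert_subspace[of U v] vec.span_superset[of "insert v U"]
    by (auto simp: between_def)
qed

text \<open>By \<open>between_unique\<close> the sets \<open>W - U\<close> partition
  \<open>V - U\<close>. With \<open>u = vec.dim U\<close> each part has \<open>q^(u+1) - q^u\<close>
  vectors out of \<open>q^(u+2) - q^u\<close>, and the factor \<open>q^u * (q - 1)\<close>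
  cancels.\<close>

lemma card_between:
  fixes U V :: "('a::{field,finite} ^ 'k::finite) set"
  assumes "vec.subspace U" "vec.subspace V" "U \<subseteq> V" "vec.dim V = vec.dim U + 2"
  shows "card (between U V) = CARD('a) + 1"
proof -
  let ?q = "CARD('a)" and ?u = "vec.dim U"
  have "V - U = (\<Union>W\<in>between U V. W - U)"
    using between_unique[OF assms(1-3)] by (auto simp: between_def)
  moreover have "card (\<Union>W\<in>between U V. W - U) = (\<Sum>W\<in>between U V. card (W - U))"
  proof (rule card_UN_disjoint)
    show "\<forall>W\<in>between U V. \<forall>W'\<in>between U V. W \<noteq> W' \<longrightarrow> (W - U) \<inter> (W' - U) = {}"
    proof (intro ballI impI, rule ccontr)
      fix W W' assume W: "W \<in> between U V" "W' \<in> between U V" "W \<noteq> W'"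
        and "(W - U) \<inter> (W' - U) \<noteq> {}"
      then obtain x where "x \<in> W" "x \<in> W'" "x \<notin> U" by blast
      moreover have "x \<in> V" using \<open>x \<in> W\<close> W by (auto simp: between_def)
      ultimately show False
        using W between_unique[OF assms(1-3), of x] by metis
    qed
  qed auto
  moreover have "card (W - U) = ?q ^ (?u + 1) - ?q ^ ?u" if "W \<in> between U V" for W
    using that assms(1) by (simp add: between_def card_Diff_subset card_subspace)
  moreover have "card (V - U) = ?q ^ (?u + 2) - ?q ^ ?u"
    using assms by (simp add: card_Diff_subset card_subspace)
  ultimately have "card (between U V) * (?q ^ (?u + 1) - ?q ^ ?u) = ?q ^ (?u + 2) - ?q ^ ?u"
    by simp
  moreover have "?q ^ (?u + 1) - ?q ^ ?u = ?q ^ ?u * (?q - 1)"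
    by (simp add: algebra_simps)
  moreover have "?q ^ (?u + 2) - ?q ^ ?u = ?q ^ ?u * ((?q - 1) * (?q + 1))"
    by (simp add: algebra_simps)
  ultimately have "?q ^ ?u * (?q - 1) * card (between U V) = ?q ^ ?u * (?q - 1) * (?q + 1)"
    by (simp only: mult.assoc mult.commute mult.left_commute)
  moreover have "?q ^ ?u * (?q - 1) \<noteq> 0"
    using two_le_card_field[where 'a='a] by simp
  ultimately show ?thesis by (metis mult_left_cancel)
qed

section \<open>Points and hyperplanes\<close>

lemma pg_pointE:
  assumes "pg_point P"
  obtains p where "p \<noteq> 0" "P = vec.span {p}"
proof -
  have P: "vec.subspace P" "vec.dim P = 1" using assms by (auto simp: pg_point_def)
  then have "\<not> P \<subseteq> {0}" by (metis vec.dim_eq_0 zero_neq_one)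
  then obtain p where p: "p \<in> P" "p \<noteq> 0" by blast
  then have "vec.span {p} \<subseteq> P" using P by (intro vec.span_minimal) auto
  then have "vec.span {p} = P"
    using P p by (intro vec.subspace_dim_equal) auto
  with p show thesis using that by blast
qed

lemma span_singleton_subset_iff:
  "vec.subspace U \<Longrightarrow> vec.span {p} \<subseteq> U \<longleftrightarrow> p \<in> U"
  using vec.span_minimal[of "{p}" U] vec.span_base[of p "{p}"] by blast

lemma dim_span_Un_point:
  fixes U :: "('a::{field,finite} ^ 'k::finite) set"
  assumes "vec.subspace U" "pg_point P" "\<not> P \<subseteq> U"
  shows "vec.dim (vec.span (P \<union> U)) = vec.dim U + 1"
proof -
  obtain p where p: "p \<noteq> 0" "P = vec.span {p}" using assms pg_pointE by blast
  have "p \<notin> U" using assms p by (simp add: span_singleton_subset_iff)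
  moreover have "vec.span (P \<union> U) = vec.span (insert p U)"
    unfolding p insert_is_Un[of p U] vec.span_Un vec.span_span ..
  ultimately show ?thesis using dim_insert_subspace[OF assms(1)] by simp
qed

lemma dim_span_Un_point_le:
  fixes U :: "('a::{field,finite} ^ 'k::finite) set"
  assumes "pg_point P"
  shows "vec.dim (P \<union> U) \<le> vec.dim U + 1"
proof -
  have "vec.span (P \<union> U) = vec.span (P \<union> vec.span U)"
    unfolding vec.span_Un vec.span_span ..
  then have eq: "vec.dim (P \<union> U) = vec.dim (P \<union> vec.span U)" by (metis vec.dim_span)
  show ?thesis
  proof (cases "P \<subseteq> vec.span U")
    case True
    then show ?thesis using eq by (simp add: Un_absorb1)
  next
    case False
    then show ?thesis using eq dim_span_Un_point[OF _ assms, of "vec.span U"] by simp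
  qed
qed

lemma hyperplane_superset:
  fixes U :: "('a::{field,finite} ^ 'k::finite) set"
  assumes "vec.subspace U" "vec.dim U < CARD('k)"
  obtains H where "pg_hyperplane H" "U \<subseteq> H"
  using assms
proof (induction "CARD('k) - vec.dim U" arbitrary: U thesis rule: less_induct)
  case less
  show ?case
  proof (cases "vec.dim U = CARD('k) - 1")
    case True
    then show ?thesis using less.prems by (auto simp: pg_hyperplane_def)
  next
    case False
    have "U \<noteq> UNIV" using less.prems vec_dim_card by (metis less_irrefl)
    then obtain x where "x \<notin> U" by blast
    then have d: "vec.dim (vec.span (insert x U)) = vec.dim U + 1"
      using less.prems by (simp add: dim_insert_subspace)
    then obtain H where "pg_hyperplane H" "vec.span (insert x U) \<subseteq> H"
      using less.hyps[of "vec.span (insert x U)"] False less.prems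
      by (metis (no_types, lifting) Suc_eq_plus1 Suc_lessI diff_Suc_1 diff_less_mono2 lessI
          vec.subspace_span)
    then show ?thesis
      using less.prems vec.span_superset[of "insert x U"] by blast
  qed
qed

lemma meet_card_mono: "U \<subseteq> V \<Longrightarrow> meet_card G U \<le> meet_card G V"
  unfolding meet_card_def
  by (induction G) (use subset_trans in auto)

lemma meet_card_strict_mono:
  assumes "U \<subseteq> V" "P \<in># G" "P \<subseteq> V" "\<not> P \<subseteq> U"
  shows "meet_card G U < meet_card G V"
proof -
  obtain G' where "G = add_mset P G'" using assms(2) by (metis mset_add)
  then show ?thesis
    using assms meet_card_mono[of U V G'] by (simp add: meet_card_def)
qed

lemma hyperplanes_between:
  fixes U :: "('a::{field,finite} ^ 'k::finite) set"
  assumes "vec.dim U + 2 = CARD('k)"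
  shows "{H. pg_hyperplane H \<and> U \<subseteq> H} = between U UNIV"
  using assms by (auto simp: between_def pg_hyperplane_def)

text \<open>Double counting of incidences: a point inside \<open>U\<close> lies on all
  \<open>q + 1\<close> hyperplanes of the pencil, a point off \<open>U\<close> only on the one it
  spans with \<open>U\<close>.\<close>

lemma sum_meet_card_pencil:
  fixes U :: "('a::{field,finite} ^ 'k::finite) set"
  assumes "vec.subspace U" "vec.dim U + 2 = CARD('k)" "\<forall>P\<in>#G. pg_point P"
  shows "(\<Sum>H | pg_hyperplane H \<and> U \<subseteq> H. meet_card G H) = size G + CARD('a) * meet_card G U"
  using assms(3)
proof (induction G)
  case empty
  then show ?case by (simp add: meet_card_def)
next
  case (add P G)
  let ?\<H> = "{H. pg_hyperplane H \<and> U \<subseteq> H}"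
  have N: "card ?\<H> = CARD('a) + 1"
    using hyperplanes_between[OF assms(2)] card_between[of U UNIV] assms vec_dim_card
    by (metis vec.subspace_UNIV subset_UNIV)
  have step: "meet_card (add_mset P G) H = meet_card G H + (if P \<subseteq> H then 1 else 0)" for H
    by (simp add: meet_card_def)
  have "(\<Sum>H\<in>?\<H>. if P \<subseteq> H then 1 else 0) = 1 + CARD('a) * (if P \<subseteq> U then 1 else 0)"
  proof (cases "P \<subseteq> U")
    case True
    then have "(\<Sum>H\<in>?\<H>. if P \<subseteq> H then 1 else 0) = (\<Sum>H\<in>?\<H>. 1 :: nat)"
      by (intro sum.cong) auto
    then show ?thesis using N True by simp
  next
    case False
    have "pg_point P" using add.prems by simp
    then obtain p where p: "p \<noteq> 0" "P = vec.span {p}" by (rule pg_pointE)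
    then have "p \<notin> U" using False assms(1) by (simp add: span_singleton_subset_iff)
    then have "H \<in> ?\<H> \<and> p \<in> H \<longleftrightarrow> H = vec.span (insert p U)" for H
      using between_unique[OF assms(1) vec.subspace_UNIV, of p H]
      unfolding hyperplanes_between[OF assms(2)] by simp
    moreover have "P \<subseteq> H \<longleftrightarrow> p \<in> H" if "H \<in> ?\<H>" for H
      using that p by (simp add: span_singleton_subset_iff pg_hyperplane_def)
    ultimately have "?\<H> \<inter> {H. P \<subseteq> H} = {vec.span (insert p U)}"
      by blast
    then show ?thesis
      using False by (simp add: sum.If_cases)
  qed
  then show ?case
    using add by (simp add: step sum.distrib algebra_simps)
qed

section \<open>Systems one point short of the maximal length\<close>

text \<open>The bound \<open>CARD('k) - 1 + s\<close> is the value of n - d for Singleton defect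
  \<open>s\<close>, and \<open>size_G\<close> is one less than the maximal length.\<close>

locale near_maximal_system =
  fixes G :: "('a::{field,finite} ^ 'k::finite) set multiset" and s :: nat
  assumes points: "\<forall>P\<in>#G. pg_point P"
    and dim_ge_3: "3 \<le> CARD('k)"
    and size_G: "size G = (s + 1) * (CARD('a) + 1) + CARD('k) - 3"
    and dvd_order: "(s + 2) dvd CARD('a)"
    and spanning: "pg_hyperplane H \<Longrightarrow> \<exists>P\<in>#G. \<not> P \<subseteq> H"
    and meet_le: "pg_hyperplane H \<Longrightarrow> meet_card G H \<le> CARD('k) - 1 + s"
begin

section \<open>Independence of the points of the system\<close>

lemma point_notin_subspace:
  assumes "vec.subspace U" "vec.dim U < CARD('k)"
  obtains P where "P \<in># G" "\<not> P \<subseteq> U"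
  using hyperplane_superset[OF assms] spanning by (metis subset_trans)

lemma card_pencil:
  fixes U :: "('a ^ 'k) set"
  assumes "vec.subspace U" "vec.dim U + 2 = CARD('k)"
  shows "card {H. pg_hyperplane H \<and> U \<subseteq> H} = CARD('a) + 1"
  unfolding hyperplanes_between[OF assms(2)]
  using assms by (intro card_between) (simp_all only: vec_dim_card vec.subspace_UNIV subset_UNIV)

text \<open>If \<open>U\<close> carries m points, summing the bound \<open>meet_le\<close> over the
  pencil of \<open>U\<close> leaves q * m \<le> q * (k - 2) + 1, which is below q * (k - 1).\<close>

lemma meet_card_codim_2:
  assumes "vec.subspace U" "vec.dim U + 2 = CARD('k)"
  shows "meet_card G U \<le> CARD('k) - 2"
proof -
  \<comment> \<open>Writing the dimension as \<open>j + 3\<close> removes the truncated subtractions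
    from the arithmetic.\<close>
  obtain j where j: "CARD('k) = j + 3" using dim_ge_3 by (metis le_add_diff_inverse2)
  let ?q = "CARD('a)" and ?\<H> = "{H. pg_hyperplane H \<and> U \<subseteq> H}"
  have "size G + ?q * meet_card G U = (\<Sum>H\<in>?\<H>. meet_card G H)"
    using sum_meet_card_pencil[OF assms points] by simp
  also have "\<dots> \<le> (\<Sum>H\<in>?\<H>. CARD('k) - 1 + s)"
    using meet_le by (intro sum_mono) auto
  also have "\<dots> = (?q + 1) * (j + 2 + s)"
    using card_pencil[OF assms] j by simp
  finally have "?q * meet_card G U \<le> ?q * (j + 1) + 1"
    using size_G j by (simp add: algebra_simps)
  also have "\<dots> < ?q * (j + 2)"
    using two_le_card_field[where 'a='a] by simp
  finally have "meet_card G U < j + 2" by (metis mult_less_cancel1)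
  then show ?thesis using j by simp
qed

text \<open>Descent from codimension 2: joining a point of \<open>G\<close> outside \<open>U\<close>
  raises the dimension by exactly one and the number of points by at least one.\<close>

lemma meet_card_le_dim:
  assumes "vec.subspace U" "vec.dim U + 2 \<le> CARD('k)"
  shows "meet_card G U \<le> vec.dim U"
  using assms
proof (induction "CARD('k) - vec.dim U" arbitrary: U rule: less_induct)
  case less
  show ?case
  proof (cases "vec.dim U + 2 = CARD('k)")
    case True
    then show ?thesis using meet_card_codim_2 less.prems by fastforce
  next
    case False
    obtain P where P: "P \<in># G" "\<not> P \<subseteq> U"
      using point_notin_subspace[of U] less.prems by auto
    let ?V = "vec.span (P \<union> U)"
    have d: "vec.dim ?V = vec.dim U + 1"
      using dim_span_Un_point[of U P] less.prems P points by blast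
    have "meet_card G ?V \<le> vec.dim ?V"
      using less.prems False d by (intro less.hyps) auto
    moreover have "meet_card G U < meet_card G ?V"
      using vec.span_superset[of "P \<union> U"] P by (intro meet_card_strict_mono[of _ _ P]) auto
    ultimately show ?thesis using d by simp
  qed
qed

text \<open>A point is a subspace of dimension 1 \<le> k - 2, so the preceding bound applies to it.
  From here on \<open>G\<close> can be treated as the plain set \<open>F\<close>.\<close>

lemma count_le_1: "count G P \<le> 1"
proof (cases "P \<in># G")
  case True
  then have P: "vec.subspace P" "vec.dim P = 1" using points by (auto simp: pg_point_def)
  have "count G P \<le> meet_card G P"
    unfolding meet_card_def by (induction G) auto
  also have "\<dots> \<le> 1"
    using meet_card_le_dim[OF P(1)] P(2) dim_ge_3 by simp
  finally show ?thesis .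
qed (simp add: not_in_iff)

definition "F = set_mset G"

lemma G_eq: "G = mset_set F"
proof (rule multiset_eqI)
  fix P
  show "count G P = count (mset_set F) P"
    using count_le_1[of P]
    by (cases "P \<in># G") (auto simp: F_def not_in_iff count_mset_set' le_Suc_eq
        simp flip: count_greater_zero_iff)
qed

lemma finite_F [simp]: "finite F"
  by (simp add: F_def)

lemma point_F: "P \<in> F \<Longrightarrow> pg_point P"
  using points by (simp add: F_def)

lemma meet_card_eq: "meet_card G H = card {P \<in> F. P \<subseteq> H}"
  unfolding meet_card_def by (subst G_eq) (simp add: filter_mset_mset_set)

lemma card_F: "card F = (s + 1) * (CARD('a) + 1) + CARD('k) - 3"
  using size_G by (subst (asm) G_eq) simp

text \<open>The span of \<open>A\<close> carries at least \<open>card A\<close> points of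
  \<open>G\<close>, so by \<open>meet_card_le_dim\<close> its dimension cannot be smaller than
  that.\<close>

lemma dim_Union_points:
  assumes "A \<subseteq> F" "card A + 2 \<le> CARD('k)"
  shows "vec.dim (\<Union>A) = card A"
proof (rule antisym)
  have "finite A" using assms finite_F finite_subset by blast
  then show le: "vec.dim (\<Union>A) \<le> card A"
    using assms(1)
  proof (induction A)
    case empty
    then show ?case by simp
  next
    case (insert P A)
    then have "vec.dim (P \<union> \<Union>A) \<le> vec.dim (\<Union>A) + 1"
      using point_F by (intro dim_span_Un_point_le) auto
    then show ?case using insert by simp
  qed
  have "card A \<le> meet_card G (vec.span (\<Union>A))"
    unfolding meet_card_eq using assms(1) vec.span_superset[of "\<Union>A"]
    by (intro card_mono) auto
  also have "\<dots> \<le> vec.dim (\<Union>A)"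
    using meet_card_le_dim[of "vec.span (\<Union>A)"] le assms by simp
  finally show "card A \<le> vec.dim (\<Union>A)" .
qed

text \<open>The span of \<open>A\<close> has dimension \<open>card A\<close>, hence no room for a
  further point of \<open>G\<close>. In particular any k - 1 points of \<open>G\<close> are
  independent.\<close>

lemma points_in_span:
  assumes "A \<subseteq> F" "card A + 2 \<le> CARD('k)"
  shows "{P \<in> F. P \<subseteq> vec.span (\<Union>A)} = A"
proof (rule card_seteq[symmetric])
  show "card {P \<in> F. P \<subseteq> vec.span (\<Union>A)} \<le> card A"
    using meet_card_le_dim[of "vec.span (\<Union>A)"] dim_Union_points[OF assms] assms(2)
    by (simp add: meet_card_eq)
qed (use assms(1) vec.span_superset[of "\<Union>A"] in auto)

section \<open>Tangent hyperplanes\<close>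

definition tangent :: "('a ^ 'k) set \<Rightarrow> bool" where
  "tangent H \<longleftrightarrow> pg_hyperplane H \<and> meet_card G H = CARD('k) - 2 + s"

lemma span_Union_subset_iff: "vec.subspace H \<Longrightarrow> vec.span (\<Union>A) \<subseteq> H \<longleftrightarrow> \<Union>A \<subseteq> H"
  using vec.span_minimal vec.span_superset by (metis subset_trans)

lemma hyperplane_subspace: "pg_hyperplane H \<Longrightarrow> vec.subspace H"
  by (simp add: pg_hyperplane_def)

text \<open>Over the pencil through the span of \<open>A\<close>, which carries exactly k - 2
  points, the amounts by which the hyperplanes fall short of the maximum add up to 1. One hyperplane
  therefore lacks one point and all others attain the maximum.\<close>

lemma tangent_unique:
  assumes "A \<subseteq> F" "card A + 2 = CARD('k)"
  obtains H where "tangent H" "\<Union>A \<subseteq> H"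
    and "\<And>H'. pg_hyperplane H' \<Longrightarrow> \<Union>A \<subseteq> H' \<Longrightarrow> H' \<noteq> H \<Longrightarrow>
      meet_card G H' = CARD('k) - 1 + s"
proof -
  obtain j where j: "CARD('k) = j + 3" using dim_ge_3 by (metis le_add_diff_inverse2)
  let ?q = "CARD('a)" and ?U = "vec.span (\<Union>A)"
  let ?\<H> = "{H. pg_hyperplane H \<and> ?U \<subseteq> H}"
  have dimU: "vec.dim ?U + 2 = CARD('k)"
    using dim_Union_points[OF assms(1)] assms(2) by simp
  have mU: "meet_card G ?U = j + 1"
    using points_in_span[OF assms(1)] assms(2) j by (simp add: meet_card_eq)
  have "(\<Sum>H\<in>?\<H>. (j + 2 + s) - meet_card G H) = (\<Sum>H\<in>?\<H>. j + 2 + s) - (\<Sum>H\<in>?\<H>. meet_card G H)"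
    using meet_le j by (intro sum_subtractf_nat) auto
  also have "(\<Sum>H\<in>?\<H>. j + 2 + s) = (?q + 1) * (j + 2 + s)"
    using card_pencil[OF vec.subspace_span dimU] by simp
  also have "(\<Sum>H\<in>?\<H>. meet_card G H) = (s + 1) * (?q + 1) + j + ?q * (j + 1)"
    using sum_meet_card_pencil[OF vec.subspace_span dimU points] mU size_G j by simp
  also have "(?q + 1) * (j + 2 + s) = (s + 1) * (?q + 1) + j + ?q * (j + 1) + 1"
    by (simp add: algebra_simps)
  also have "\<dots> - ((s + 1) * (?q + 1) + j + ?q * (j + 1)) = 1"
    by (rule diff_add_inverse)
  finally have "\<exists>H\<in>?\<H>. (j + 2 + s) - meet_card G H = 1 \<and>
      (\<forall>H'\<in>?\<H>. H \<noteq> H' \<longrightarrow> (j + 2 + s) - meet_card G H' = 0)"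
    by (subst (asm) sum_eq_1_iff) auto
  then obtain H where "H \<in> ?\<H>" and m: "(j + 2 + s) - meet_card G H = 1"
    and H': "\<forall>H'\<in>?\<H>. H \<noteq> H' \<longrightarrow> (j + 2 + s) - meet_card G H' = 0"
    by (elim bexE conjE) (rule that)
  then have H: "pg_hyperplane H" "?U \<subseteq> H" by simp_all
  show thesis
  proof
    show "tangent H" using H m meet_le[of H] j by (simp add: tangent_def)
    show "\<Union>A \<subseteq> H" using H by (simp add: span_Union_subset_iff hyperplane_subspace)
    show "meet_card G H' = CARD('k) - 1 + s"
      if "pg_hyperplane H'" "\<Union>A \<subseteq> H'" "H' \<noteq> H" for H'
      using that bspec[OF H', of H'] meet_le[of H'] j
      by (simp add: span_Union_subset_iff hyperplane_subspace)
  qed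
qed

text \<open>Any k - 2 points of \<open>G\<close> in \<open>H\<close> put \<open>H\<close> into a
  pencil governed by \<open>tangent_unique\<close>. The resulting gap in the intersection numbers
  drives the divisibility argument.\<close>

lemma meet_card_cases:
  assumes "pg_hyperplane H" "CARD('k) - 2 \<le> meet_card G H"
  shows "tangent H \<or> meet_card G H = CARD('k) - 1 + s"
proof -
  obtain A where "A \<subseteq> {P \<in> F. P \<subseteq> H}" "card A = CARD('k) - 2"
    using assms(2) unfolding meet_card_eq by (rule obtain_subset_with_card_n)
  then have A: "A \<subseteq> F" "\<Union>A \<subseteq> H" "card A + 2 = CARD('k)"
    using dim_ge_3 by auto
  show ?thesis
    using tangent_unique[OF A(1,3)] A(2) assms(1) by blast
qed

section \<open>Intersections of tangent hyperplanes\<close>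

definition tangents :: "('a ^ 'k) set set \<Rightarrow> ('a ^ 'k) set set" where
  "tangents A = {H. tangent H \<and> \<Union>A \<subseteq> H}"

text \<open>The candidate for the span of \<open>A\<close> and the missing point, defined before
  that point is known. An empty family of tangents would give the whole space.\<close>

definition Q :: "('a ^ 'k) set set \<Rightarrow> ('a ^ 'k) set" where
  "Q A = \<Inter> (tangents A)"

lemma subspace_Q: "vec.subspace (Q A)"
  unfolding Q_def by (rule vec.subspace_Inter) (auto simp: tangents_def tangent_def pg_hyperplane_def)

lemma Union_subset_Q: "\<Union>A \<subseteq> Q A"
  by (auto simp: Q_def tangents_def)

lemma Q_mono: "A \<subseteq> B \<Longrightarrow> Q A \<subseteq> Q B"
  unfolding Q_def tangents_def by (intro Inter_anti_mono Collect_mono) blast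

text \<open>Applied in contrapositive form: where the two sides have different dimensions,
  \<open>P\<close> lies outside \<open>Q A\<close>.\<close>

lemma Q_insert_absorb: "P \<subseteq> Q A \<Longrightarrow> Q (insert P A) = Q A"
proof -
  assume "P \<subseteq> Q A"
  then have "tangents (insert P A) = tangents A"
    by (auto simp: Q_def tangents_def)
  then show ?thesis by (simp add: Q_def)
qed

text \<open>By \<open>tangent_unique\<close> each of the (s + 1) * (q + 1) points of
  \<open>F - A\<close> lies on exactly one tangent hyperplane through \<open>A\<close>, and each of
  these carries (k - 2 + s) - (k - 3) = s + 1 of them.\<close>

lemma card_tangents:
  assumes "A \<subseteq> F" "card A + 3 = CARD('k)"
  shows "card (tangents A) = CARD('a) + 1"
proof -
  let ?R = "\<lambda>H. {P \<in> F - A. P \<subseteq> H}"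
  have finA: "finite A" using assms(1) finite_F finite_subset by blast
  have uniq: "\<exists>!H. H \<in> tangents A \<and> P \<subseteq> H" if "P \<in> F - A" for P
  proof -
    have "card (insert P A) + 2 = CARD('k)" "insert P A \<subseteq> F"
      using that assms finA by auto
    then obtain H where H: "tangent H" "\<Union>(insert P A) \<subseteq> H"
      and other: "\<And>H'. pg_hyperplane H' \<Longrightarrow> \<Union>(insert P A) \<subseteq> H' \<Longrightarrow> H' \<noteq> H \<Longrightarrow>
      meet_card G H' = CARD('k) - 1 + s"
      using tangent_unique by metis
    have neq: "CARD('k) - 1 + s \<noteq> CARD('k) - 2 + s" using dim_ge_3 by simp
    show ?thesis
    proof (rule ex1I[of _ H])
      show "H \<in> tangents A \<and> P \<subseteq> H" using H by (simp add: tangents_def)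
      show "H' = H" if "H' \<in> tangents A \<and> P \<subseteq> H'" for H'
      proof (rule ccontr)
        assume "H' \<noteq> H"
        then show False
          using that other[of H'] neq unfolding tangents_def tangent_def by simp
      qed
    qed
  qed
  have FA: "F - A = (\<Union>H\<in>tangents A. ?R H)"
    using uniq[THEN ex1_implies_ex] by (intro equalityI subsetI) auto
  have disj: "card (\<Union>H\<in>tangents A. ?R H) = (\<Sum>H\<in>tangents A. card (?R H))"
  proof (rule card_UN_disjoint)
    show "\<forall>H\<in>tangents A. \<forall>H'\<in>tangents A. H \<noteq> H' \<longrightarrow> ?R H \<inter> ?R H' = {}"
    proof (intro ballI impI, rule ccontr)
      fix H H' assume "H \<in> tangents A" "H' \<in> tangents A" "H \<noteq> H'" "?R H \<inter> ?R H' \<noteq> {}"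
      then obtain P where "P \<in> F - A" "P \<subseteq> H" "P \<subseteq> H'" by auto
      with uniq \<open>H \<in> tangents A\<close> \<open>H' \<in> tangents A\<close> \<open>H \<noteq> H'\<close> show False by metis
    qed
  qed auto
  have R: "card (?R H) = s + 1" if "H \<in> tangents A" for H
  proof -
    have "?R H = {P \<in> F. P \<subseteq> H} - A" by blast
    moreover have "A \<subseteq> {P \<in> F. P \<subseteq> H}" using that assms(1) by (auto simp: tangents_def)
    ultimately have "card (?R H) = meet_card G H - card A"
      using finA by (simp add: card_Diff_subset meet_card_eq)
    then show ?thesis using that assms(2) by (simp add: tangents_def tangent_def)
  qed
  have "card (tangents A) * (s + 1) = (\<Sum>H\<in>tangents A. card (?R H))"
    using R by simp
  also have "\<dots> = card (F - A)"
    by (subst FA) (rule disj[symmetric])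
  also have "\<dots> = (CARD('a) + 1) * (s + 1)"
    using assms(1) card_F finA by (simp add: card_Diff_subset flip: assms(2))
  finally show ?thesis by (rule mult_right_cancel[THEN iffD1, rotated]) simp
qed

text \<open>Otherwise every hyperplane through \<open>W\<close> carries \<open>j\<close> or
  \<open>j + s + 2\<close> points, where \<open>j = card A\<close>, so the excesses over
  \<open>j\<close> sum to a multiple of \<open>s + 2\<close>. The pencil count gives q * (...) + (s
  + 1) for this sum, and \<open>s + 2\<close> divides q but not \<open>s + 1\<close>.\<close>

lemma tangent_cover:
  assumes A: "A \<subseteq> F" "card A + 3 = CARD('k)"
    and W: "vec.subspace W" "vec.dim W + 2 = CARD('k)" "\<Union>A \<subseteq> W"
  shows "\<exists>H\<in>tangents A. W \<subseteq> H"
proof (rule ccontr)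
  assume no: "\<not> (\<exists>H\<in>tangents A. W \<subseteq> H)"
  let ?q = "CARD('a)" and ?\<H> = "{H. pg_hyperplane H \<and> W \<subseteq> H}"
  define j where "j = card A"
  have k: "CARD('k) = j + 3" using A(2) j_def by simp
  have "card A \<le> meet_card G W"
    unfolding meet_card_eq using A(1) W(3) by (intro card_mono) auto
  then have jm: "j \<le> meet_card G W" by (simp add: j_def)
  have dvd: "(s + 2) dvd (meet_card G H - j)" and ge: "j \<le> meet_card G H" if "H \<in> ?\<H>" for H
  proof -
    have "meet_card G W \<le> meet_card G H"
      using that by (intro meet_card_mono) simp
    then show "j \<le> meet_card G H" using jm by linarith
    have "\<not> tangent H" using that no W(3) by (auto simp: tangents_def)
    \<comment> \<open>Since \<open>j + 1\<close> is \<open>CARD('k) - 2\<close>, a single point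
      beyond \<open>j\<close> already makes \<open>meet_card_cases\<close> applicable.\<close>
    then have "j + 1 \<le> meet_card G H \<Longrightarrow> meet_card G H = j + 2 + s"
      using meet_card_cases[of H] that k by simp
    then have "meet_card G H - j = 0 \<or> meet_card G H - j = s + 2" by linarith
    then show "(s + 2) dvd (meet_card G H - j)" by auto
  qed
  have "(\<Sum>H\<in>?\<H>. meet_card G H - j) = (\<Sum>H\<in>?\<H>. meet_card G H) - (\<Sum>H\<in>?\<H>. j)"
    using ge by (rule sum_subtractf_nat)
  also have "(\<Sum>H\<in>?\<H>. j) = (?q + 1) * j"
    using card_pencil[OF W(1,2)] by simp
  also have "(\<Sum>H\<in>?\<H>. meet_card G H) = (s + 1) * (?q + 1) + j + ?q * meet_card G W"
    using sum_meet_card_pencil[OF W(1,2) points] size_G k by simp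
  also have "\<dots> - (?q + 1) * j = (s + 1) * (?q + 1) + ?q * meet_card G W - ?q * j"
    by simp
  also have "\<dots> = (s + 1) * (?q + 1) + ?q * (meet_card G W - j)"
    using jm by (simp only: diff_mult_distrib2 Nat.diff_add_assoc mult_le_mono2)
  also have "\<dots> = ?q * (s + 1 + (meet_card G W - j)) + (s + 1)"
    by (simp add: algebra_simps)
  finally have "(s + 2) dvd ?q * (s + 1 + (meet_card G W - j)) + (s + 1)"
    using dvd by (metis (no_types, lifting) dvd_sum)
  then have "(s + 2) dvd (s + 1)"
    using dvd_order by (metis dvd_add_right_iff dvd_mult2)
  then show False by (auto dest: dvd_imp_le)
qed

lemma Q_eq_tangent:
  assumes "A \<subseteq> F" "card A + 2 = CARD('k)"
  shows "tangent (Q A)"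
    and "\<And>H. pg_hyperplane H \<Longrightarrow> \<Union>A \<subseteq> H \<Longrightarrow> H \<noteq> Q A \<Longrightarrow>
      meet_card G H = CARD('k) - 1 + s"
proof -
  obtain H where H: "tangent H" "\<Union>A \<subseteq> H"
    and other: "\<And>H'. pg_hyperplane H' \<Longrightarrow> \<Union>A \<subseteq> H' \<Longrightarrow> H' \<noteq> H \<Longrightarrow>
      meet_card G H' = CARD('k) - 1 + s"
    using tangent_unique[OF assms] by metis
  have neq: "CARD('k) - 1 + s \<noteq> CARD('k) - 2 + s" using dim_ge_3 by simp
  have "tangents A = {H}"
  proof (intro equalityI subsetI)
    fix H' assume "H' \<in> tangents A"
    then have H': "pg_hyperplane H'" "\<Union>A \<subseteq> H'" "meet_card G H' = CARD('k) - 2 + s"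
      by (auto simp: tangents_def tangent_def)
    show "H' \<in> {H}"
    proof (rule ccontr)
      assume "H' \<notin> {H}"
      then show False using other[OF H'(1,2)] H'(3) neq by simp
    qed
  qed (use H in \<open>simp add: tangents_def\<close>)
  then have "Q A = H" by (simp add: Q_def)
  then show "tangent (Q A)"
    and "\<And>H. pg_hyperplane H \<Longrightarrow> \<Union>A \<subseteq> H \<Longrightarrow> H \<noteq> Q A \<Longrightarrow>
      meet_card G H = CARD('k) - 1 + s"
    using H other by simp_all
qed

section \<open>The dimension of \<open>Q A\<close>\<close>

lemma dim_Int_hyperplanes:
  fixes H H' :: "('a ^ 'k) set"
  assumes "pg_hyperplane H" "pg_hyperplane H'" "H \<noteq> H'"
  shows "vec.dim (H \<inter> H') + 2 = CARD('k)"
proof -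
  have H: "vec.subspace H" "vec.subspace H'" "vec.dim H = CARD('k) - 1" "vec.dim H' = CARD('k) - 1"
    using assms by (auto simp: pg_hyperplane_def)
  have "\<not> H' \<subseteq> H"
    using H assms(3) vec.subspace_dim_equal[of H' H] by auto
  then have "vec.dim H' = vec.dim (H \<inter> H') + 1"
    using H dim_ge_3
    by (intro dim_Int_hyperplane[OF vec.subspace_UNIV]) (simp_all only: vec_dim_card subset_UNIV, simp)
  then show ?thesis using H dim_ge_3 by simp
qed

text \<open>Modulo the span of \<open>A\<close> the tangent hyperplanes are q + 1 lines covering all
  points of a projective plane. A non-tangent line \<open>H\<close> through the common point of two
  of them would need q + 1 distinct intersections to be covered, yet those two meet it in the same
  point. So the tangents are precisely the pencil of that point.\<close>

lemma dim_Q_codim_2: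
  assumes A: "A \<subseteq> F" "card A + 3 = CARD('k)"
  shows "vec.dim (Q A) = card A + 1"
proof -
  let ?U = "vec.span (\<Union>A)"
  have U: "vec.dim ?U = card A" using dim_Union_points[OF A(1)] A(2) by simp
  have hyp: "pg_hyperplane H" "?U \<subseteq> H" "vec.subspace H" "vec.dim H = card A + 2"
    if "H \<in> tangents A" for H
    using that A(2)
    by (auto simp: tangents_def tangent_def pg_hyperplane_def vec.span_minimal
        intro: vec.span_minimal[THEN subsetD])
  have "\<not> card (tangents A) \<le> 1"
    using card_tangents[OF A] two_le_card_field[where 'a='a] by simp
  then obtain H1 H2 where H12: "H1 \<in> tangents A" "H2 \<in> tangents A" "H1 \<noteq> H2"
    by (metis card_le_Suc0_iff_eq finite One_nat_def)
  let ?W = "H1 \<inter> H2"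
  have W: "vec.subspace ?W" "vec.dim ?W + 2 = CARD('k)"
    using hyp[OF H12(1)] hyp[OF H12(2)] H12(3) dim_Int_hyperplanes by (auto intro: vec.subspace_inter)
  have all_tangent: "H \<in> tangents A" if H: "pg_hyperplane H" "?W \<subseteq> H" for H
  proof (rule ccontr)
    assume nt: "H \<notin> tangents A"
    have sH: "vec.subspace H" "vec.dim H = card A + 2"
      using H A(2) by (auto simp: pg_hyperplane_def)
    have UH: "?U \<subseteq> H" using hyp(2)[OF H12(1)] hyp(2)[OF H12(2)] H(2) by blast
    have dim_meet: "vec.dim (H' \<inter> H) = card A + 1" if "H' \<in> tangents A" for H'
      using dim_Int_hyperplanes[of H' H] hyp(1)[OF that] H(1) nt that A(2) by fastforce
    \<comment> \<open>The covering property makes this map onto a set of the same size, although \<open>H1\<close> and \<open>H2\<close> have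
      the same image.\<close>
    have "(\<lambda>H'. H' \<inter> H) ` tangents A = between ?U H"
    proof (intro equalityI subsetI)
      fix V assume "V \<in> (\<lambda>H'. H' \<inter> H) ` tangents A"
      then show "V \<in> between ?U H"
        using hyp dim_meet UH U sH by (auto simp: between_def intro: vec.subspace_inter)
    next
      fix V assume V: "V \<in> between ?U H"
      have "\<Union>A \<subseteq> V"
        using V span_Union_subset_iff[of V A] unfolding between_def by blast
      then obtain H' where H': "H' \<in> tangents A" "V \<subseteq> H'"
        using tangent_cover[OF A, of V] V U A(2) by (auto simp: between_def)
      have "V = H' \<inter> H"
        using V H' dim_meet[OF H'(1)] U hyp(3)[OF H'(1)] sH(1)
        by (intro vec.subspace_dim_equal) (auto simp: between_def intro: vec.subspace_inter)
      with H' show "V \<in> (\<lambda>H'. H' \<inter> H) ` tangents A" by blast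
    qed
    then have "card ((\<lambda>H'. H' \<inter> H) ` tangents A) = card (tangents A)"
      using card_tangents[OF A] card_between[of ?U H] sH UH U by simp
    then have inj: "inj_on (\<lambda>H'. H' \<inter> H) (tangents A)"
      by (intro eq_card_imp_inj_on) auto
    have "?W = H' \<inter> H" if "H' \<in> tangents A" "?W \<subseteq> H'" for H'
      using that H dim_meet[OF that(1)] W A(2) hyp(3)[OF that(1)] sH(1)
      by (intro vec.subspace_dim_equal) (auto intro: vec.subspace_inter)
    then have "H1 \<inter> H = H2 \<inter> H" using H12 by (metis Int_lower1 Int_lower2)
    then show False using inj H12 by (auto dest: inj_onD)
  qed
  \<comment> \<open>The inclusion of the pencil in the tangents is an equality because both have q +
    1 members.\<close>
  have "{H. pg_hyperplane H \<and> ?W \<subseteq> H} = tangents A"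
    using all_tangent card_tangents[OF A] card_pencil[OF W]
    by (intro card_subset_eq) auto
  then have "?W \<subseteq> Q A" unfolding Q_def by blast
  moreover have "Q A \<subseteq> ?W" using H12 by (auto simp: Q_def)
  ultimately show ?thesis using W(2) A(2) by simp
qed

text \<open>A tangent hyperplane through \<open>A\<close> carries more than \<open>card A\<close>
  points of \<open>G\<close>, so it is also tangent through \<open>insert P A\<close> for some new
  \<open>P\<close>.\<close>

lemma Q_eq_Inter:
  assumes "A \<subseteq> F" "card A + 3 \<le> CARD('k)"
  shows "Q A = (\<Inter>P\<in>F - A. Q (insert P A))"
proof
  show "Q A \<subseteq> (\<Inter>P\<in>F - A. Q (insert P A))"
    using Q_mono by (intro INT_greatest) blast
  show "(\<Inter>P\<in>F - A. Q (insert P A)) \<subseteq> Q A"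
    unfolding Q_def[of A]
  proof (rule Inter_greatest)
    fix H assume H: "H \<in> tangents A"
    have "finite A" using assms(1) finite_F finite_subset by blast
    moreover have "card A < card {P \<in> F. P \<subseteq> H}"
      using H assms(2) by (simp add: tangents_def tangent_def meet_card_eq)
    ultimately obtain P where P: "P \<in> F" "P \<subseteq> H" "P \<notin> A"
      using card_mono[of A "{P \<in> F. P \<subseteq> H}"] by fastforce
    then have "Q (insert P A) \<subseteq> H"
      using H by (auto simp: Q_def tangents_def)
    with P show "(\<Inter>P\<in>F - A. Q (insert P A)) \<subseteq> H" by blast
  qed
qed

text \<open>Modulo the span of \<open>A\<close>, each \<open>L P\<close> is a line and each
  \<open>E P P'\<close> with \<open>P \<noteq> P'\<close> is a plane containing \<open>L P\<close>
  and \<open>L P'\<close>. The lines thus meet pairwise, and since the points of \<open>G\<close> do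
  not all lie in one such plane, the lines are concurrent; \<open>Q A\<close> is their common
  point.\<close>

lemma dim_Q_step:
  assumes A: "A \<subseteq> F" "card A + 4 \<le> CARD('k)"
    and IH1: "\<And>P. P \<in> F - A \<Longrightarrow> vec.dim (Q (insert P A)) = card A + 2"
    and IH2: "\<And>P P'. P \<in> F - A \<Longrightarrow> P' \<in> F - A \<Longrightarrow> P \<noteq> P' \<Longrightarrow>
      vec.dim (Q (insert P' (insert P A))) = card A + 3"
  shows "vec.dim (Q A) = card A + 1"
proof -
  define L where "L P = Q (insert P A)" for P
  define E where "E P P' = Q (insert P' (insert P A))" for P P'
  have sub: "vec.subspace (L P)" "vec.subspace (E P P')" for P P'
    by (simp_all add: L_def E_def subspace_Q)
  have LE: "L P \<subseteq> E P P'" "L P' \<subseteq> E P P'" for P P'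
    unfolding L_def E_def by (intro Q_mono; blast)+
  have in_L: "P \<subseteq> L P" for P
    unfolding L_def using Union_subset_Q[of "insert P A"] by auto
  have notin_L: "\<not> P' \<subseteq> L P" if "P \<in> F - A" "P' \<in> F - A" "P \<noteq> P'" for P P'
    using Q_insert_absorb[of P' "insert P A"] IH1[of P] IH2[of P P'] that
    unfolding L_def by auto
  have dim_LL: "vec.dim (L P \<inter> L P') = card A + 1" if "P \<in> F - A" "P' \<in> F - A" "P \<noteq> P'" for P P'
  proof -
    have "\<not> L P' \<subseteq> L P" using notin_L[OF that] in_L by blast
    then have "vec.dim (L P') = vec.dim (L P \<inter> L P') + 1"
      using IH1 IH2 that sub LE
      by (intro dim_Int_hyperplane[of "E P P'"]) (auto simp: L_def E_def)
    then show ?thesis using IH1[of P'] that by (simp add: L_def)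
  qed
  \<comment> \<open>The third line leaves the plane of the first two, so it meets that plane in a
    single point, which has to lie on both of them.\<close>
  have conc: "L P1 \<inter> L P2 \<subseteq> L P3"
    if P: "P1 \<in> F - A" "P2 \<in> F - A" "P3 \<in> F - A" "P1 \<noteq> P2" "P1 \<noteq> P3" "P2 \<noteq> P3"
      and out: "\<not> P3 \<subseteq> E P1 P2" for P1 P2 P3
  proof -
    have "L P3 \<inter> E P1 P2 \<noteq> L P3" using out in_L[of P3] by blast
    then have "vec.dim (L P3 \<inter> E P1 P2) \<noteq> card A + 2"
      using vec.subspace_dim_equal[of "L P3 \<inter> E P1 P2" "L P3"] sub IH1[OF P(3)]
      by (auto simp: L_def vec.subspace_inter)
    moreover have "vec.dim (L P3 \<inter> E P1 P2) \<le> card A + 2"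
      using vec.dim_subset[of "L P3 \<inter> E P1 P2" "L P3"] IH1[OF P(3)] by (simp add: L_def)
    ultimately have le: "vec.dim (L P3 \<inter> E P1 P2) \<le> card A + 1" by simp
    have "L P3 \<inter> L P = L P3 \<inter> E P1 P2" if "P = P1 \<or> P = P2" for P
    proof (rule vec.subspace_dim_equal)
      have "vec.dim (L P3 \<inter> L P) = card A + 1" using that P dim_LL by metis
      then show "vec.dim (L P3 \<inter> E P1 P2) \<le> vec.dim (L P3 \<inter> L P)" using le by simp
      show "L P3 \<inter> L P \<subseteq> L P3 \<inter> E P1 P2" using that LE by blast
    qed (simp_all add: sub vec.subspace_inter)
    then have "L P3 \<inter> L P1 \<subseteq> L P1 \<inter> L P2" by blast
    then have "L P3 \<inter> L P1 = L P1 \<inter> L P2"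
      using P sub dim_LL[of P3 P1] dim_LL[of P1 P2]
      by (intro vec.subspace_dim_equal) (auto simp: vec.subspace_inter)
    then show ?thesis by blast
  qed
  have finA: "finite A" using A(1) finite_F finite_subset by blast
  have "card A + 1 < card F"
    using card_F A(2) by simp
  then have "\<not> card (F - A) \<le> 1"
    using finA A(1) by (simp add: card_Diff_subset)
  then obtain P1 P2 where P12: "P1 \<in> F - A" "P2 \<in> F - A" "P1 \<noteq> P2"
    by (metis card_le_Suc0_iff_eq finite One_nat_def)
  have "vec.dim (E P1 P2) < CARD('k)"
    using IH2[OF P12] A(2) by (simp add: E_def)
  \<comment> \<open>An auxiliary point off the plane of the first two lines; \<open>L R\<close>
    passes through their common point and serves for the points \<open>P\<close> inside that
    plane.\<close>
  then obtain R where "R \<in># G" "\<not> R \<subseteq> E P1 P2"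
    using point_notin_subspace sub by metis
  then have R: "R \<in> F - A" "R \<noteq> P1" "R \<noteq> P2" "\<not> R \<subseteq> E P1 P2"
    using Union_subset_Q[of "insert P2 (insert P1 A)"] by (auto simp: F_def E_def)
  have "L P1 \<inter> L P2 \<subseteq> L P" if P: "P \<in> F - A" for P
  proof -
    have LR: "L P1 \<inter> L P2 \<subseteq> L R"
      using conc P12 R by auto
    consider "P = P1 \<or> P = P2 \<or> P = R" | "P \<noteq> P1" "P \<noteq> P2" "P \<noteq> R" "\<not> P \<subseteq> E P1 P2"
      | "P \<noteq> P1" "P \<noteq> P2" "P \<noteq> R" "P \<subseteq> E P1 P2" by blast
    then show ?thesis
    proof cases
      case 1
      then show ?thesis using LR by blast
    next
      case 2
      then show ?thesis using conc P12 P by auto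
    next
      case 3
      \<comment> \<open>The two distinct planes share only the line \<open>L P1\<close>, which
        misses \<open>P\<close>. Hence \<open>P\<close> is off the plane \<open>E P1 R\<close>, and
        \<open>conc\<close> applies to \<open>P1\<close>, \<open>R\<close>,
        \<open>P\<close>.\<close>
      let ?D = "E P1 P2 \<inter> E P1 R"
      have "R \<subseteq> E P1 R" using in_L LE by blast
      then have "?D \<noteq> E P1 R" using R(4) by blast
      then have "vec.dim ?D \<noteq> card A + 3"
        using vec.subspace_dim_equal[of ?D "E P1 R"] sub IH2[OF P12(1) R(1)] R(2)
        by (auto simp: E_def vec.subspace_inter)
      moreover have "vec.dim ?D \<le> card A + 3"
        using vec.dim_subset[of ?D "E P1 R"] IH2[OF P12(1) R(1)] R(2) by (auto simp: E_def)
      ultimately have "L P1 = ?D"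
        using LE sub IH1[OF P12(1)]
        by (intro vec.subspace_dim_equal) (auto simp: L_def vec.subspace_inter)
      then have "\<not> P \<subseteq> E P1 R"
        using notin_L[OF P12(1) P] 3 by blast
      then have "L P1 \<inter> L R \<subseteq> L P"
        using conc[of P1 R P] P12 R P 3 by auto
      then show ?thesis using LR by blast
    qed
  qed
  then have "Q A = L P1 \<inter> L P2"
    using Q_eq_Inter[OF A(1)] A(2) P12 by (auto simp: L_def)
  then show ?thesis using dim_LL[OF P12] by simp
qed

text \<open>Descending induction on \<open>card A\<close>. Two base cases, k - 2 and k - 3, are
  required because \<open>dim_Q_step\<close> looks at sets with one and with two more
  points.\<close>

lemma dim_Q:
  assumes "A \<subseteq> F" "card A + 2 \<le> CARD('k)"
  shows "vec.dim (Q A) = card A + 1"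
  using assms
proof (induction "CARD('k) - card A" arbitrary: A rule: less_induct)
  case less
  have finA: "finite A" using less.prems(1) finite_F finite_subset by blast
  consider "card A + 2 = CARD('k)" | "card A + 3 = CARD('k)" | "card A + 4 \<le> CARD('k)"
    using less.prems by linarith
  then show ?case
  proof cases
    case 1
    then show ?thesis
      using Q_eq_tangent(1)[OF less.prems(1)] by (simp add: tangent_def pg_hyperplane_def)
  next
    case 2
    then show ?thesis using dim_Q_codim_2 less.prems by simp
  next
    case 3
    show ?thesis
    proof (rule dim_Q_step[OF less.prems(1) 3])
      fix P assume P: "P \<in> F - A"
      then show "vec.dim (Q (insert P A)) = card A + 2"
        using less.hyps[of "insert P A"] less.prems 3 finA by auto
      fix P' assume "P' \<in> F - A" "P \<noteq> P'"
      then show "vec.dim (Q (insert P' (insert P A))) = card A + 3"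
        using less.hyps[of "insert P' (insert P A)"] P less.prems 3 finA by auto
    qed
  qed
qed

section \<open>Existence and uniqueness of the extension point\<close>

lemma pg_point_Q_empty: "pg_point (Q {})"
  using dim_Q[of "{}"] dim_ge_3 subspace_Q by (simp add: pg_point_def)

text \<open>Each new point \<open>P\<close> lies outside \<open>Q A\<close> and raises the dimension
  by exactly one, so \<open>Q (insert P A)\<close> is the span of \<open>P\<close> and
  \<open>Q A\<close>. Inductively \<open>Q A\<close> is spanned by \<open>Q {}\<close> and
  \<open>A\<close>.\<close>

lemma Q_least:
  assumes "A \<subseteq> F" "card A + 2 \<le> CARD('k)" "vec.subspace H" "Q {} \<subseteq> H" "\<Union>A \<subseteq> H"
  shows "Q A \<subseteq> H"
proof -
  have "finite A" using assms(1) finite_F finite_subset by blast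
  then show ?thesis
    using assms
  proof (induction A)
    case empty
    then show ?case by simp
  next
    case (insert P A)
    have dims: "vec.dim (Q A) = card A + 1" "vec.dim (Q (insert P A)) = card A + 2"
      using dim_Q[of A] dim_Q[of "insert P A"] insert by auto
    then have "\<not> P \<subseteq> Q A" using Q_insert_absorb[of P A] by auto
    then have "vec.dim (vec.span (P \<union> Q A)) = card A + 2"
      using dim_span_Un_point[OF subspace_Q, of P A] point_F insert.prems(1) dims by simp
    moreover have "vec.span (P \<union> Q A) \<subseteq> Q (insert P A)"
      using Union_subset_Q[of "insert P A"] Q_mono[of A "insert P A"]
      by (intro vec.span_minimal subspace_Q) auto
    ultimately have "vec.span (P \<union> Q A) = Q (insert P A)"
      using dims by (intro vec.subspace_dim_equal subspace_Q) auto
    moreover have "Q A \<subseteq> H" using insert by simp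
    then have "vec.span (P \<union> Q A) \<subseteq> H"
      using insert.prems by (intro vec.span_minimal) auto
    ultimately show ?case by simp
  qed
qed

text \<open>If the bound failed, choosing k - 2 points \<open>A\<close> of \<open>G\<close> in
  \<open>H\<close> would give \<open>Q A \<subseteq> H\<close> by \<open>Q_least\<close>, hence
  equality by dimension, and \<open>H\<close> would be tangent after all.\<close>

lemma meet_card_through_Q_empty:
  assumes "pg_hyperplane H" "Q {} \<subseteq> H"
  shows "meet_card G H \<le> CARD('k) - 2 + s"
proof (rule ccontr)
  assume not_le: "\<not> meet_card G H \<le> CARD('k) - 2 + s"
  then have "CARD('k) - 2 \<le> meet_card G H" by simp
  then obtain A where "A \<subseteq> {P \<in> F. P \<subseteq> H}" "card A = CARD('k) - 2"
    unfolding meet_card_eq by (rule obtain_subset_with_card_n)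
  then have A: "A \<subseteq> F" "\<Union>A \<subseteq> H" "card A + 2 = CARD('k)"
    using dim_ge_3 by auto
  have t: "tangent (Q A)" using Q_eq_tangent(1) A by blast
  have "Q A \<subseteq> H" using Q_least A assms by (simp add: hyperplane_subspace)
  then have "Q A = H"
    using t assms(1) by (intro vec.subspace_dim_equal) (auto simp: tangent_def pg_hyperplane_def)
  then show False using t not_le by (simp add: tangent_def)
qed

text \<open>For a second point \<open>Y\<close>, some k - 2 points \<open>A\<close> of
  \<open>G\<close> span the whole space together with \<open>Y\<close> and \<open>Q {}\<close>. Then
  \<open>Y\<close> is not in \<open>Q A\<close>, so the hyperplane spanned by \<open>Y\<close> and
  \<open>A\<close> is not the tangent one and attains the maximum, against
  \<open>meet_Y\<close>.\<close>

lemma extension_point_unique: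
  assumes Y: "pg_point Y"
    and meet_Y: "\<And>H. pg_hyperplane H \<Longrightarrow> Y \<subseteq> H \<Longrightarrow> meet_card G H \<le> CARD('k) - 2 + s"
  shows "Y = Q {}"
proof (rule ccontr)
  let ?X = "Q {}"
  assume "Y \<noteq> ?X"
  have X: "vec.subspace ?X" "vec.dim ?X = 1" using pg_point_Q_empty by (auto simp: pg_point_def)
  have "\<not> Y \<subseteq> ?X"
    using \<open>Y \<noteq> ?X\<close> X Y vec.subspace_dim_equal[of Y ?X] by (auto simp: pg_point_def)
  then have dimXY: "vec.dim (Y \<union> ?X) = 2"
    using dim_span_Un_point[OF X(1) Y] X(2) by simp
  \<comment> \<open>Greedy choice: as long as the span is proper, some point of \<open>G\<close>
    lies outside it.\<close>
  have basis: "\<exists>A\<subseteq>F. card A = i \<and> vec.dim (\<Union>A \<union> (Y \<union> ?X)) = i + 2" if "i + 2 \<le> CARD('k)" for i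
    using that
  proof (induction i)
    case 0
    then show ?case using dimXY by (intro exI[of _ "{}"]) simp
  next
    case (Suc i)
    then obtain A where A: "A \<subseteq> F" "card A = i" "vec.dim (\<Union>A \<union> (Y \<union> ?X)) = i + 2" by auto
    let ?V = "vec.span (\<Union>A \<union> (Y \<union> ?X))"
    obtain P where P: "P \<in># G" "\<not> P \<subseteq> ?V"
      using point_notin_subspace[of ?V] A(3) Suc.prems by auto
    have "vec.span (P \<union> ?V) = vec.span (P \<union> (\<Union>A \<union> (Y \<union> ?X)))"
      unfolding vec.span_Un[of P] vec.span_span ..
    then have "vec.dim (P \<union> (\<Union>A \<union> (Y \<union> ?X))) = i + 3"
      using dim_span_Un_point[of ?V P] P points A(3)
        vec.dim_span[of "P \<union> (\<Union>A \<union> (Y \<union> ?X))"] by simp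
    moreover have "P \<notin> A" using P(2) vec.span_superset[of "\<Union>A \<union> (Y \<union> ?X)"] by blast
    moreover have "finite A" using A(1) finite_F finite_subset by blast
    ultimately show ?case
      using A P by (intro exI[of _ "insert P A"]) (simp add: F_def Un_assoc)
  qed
  have k: "CARD('k) - 2 + 2 = CARD('k)"
    using dim_ge_3 by simp
  then obtain A where A: "A \<subseteq> F" "card A + 2 = CARD('k)"
    and dimV: "vec.dim (\<Union>A \<union> (Y \<union> ?X)) = CARD('k)"
    using basis[OF eq_imp_le, OF k] dim_ge_3 unfolding k by auto
  let ?U = "vec.span (\<Union>A)"
  have Q: "pg_hyperplane (Q A)" using Q_eq_tangent(1)[OF A] by (simp add: tangent_def)
  have notin: "\<not> Y \<subseteq> Q A"
  proof
    assume "Y \<subseteq> Q A"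
    then have "\<Union>A \<union> (Y \<union> ?X) \<subseteq> Q A"
      using Union_subset_Q Q_mono[of "{}" A] by auto
    then have "CARD('k) \<le> vec.dim (Q A)"
      using dimV vec.dim_subset by metis
    then show False using Q dim_ge_3 by (simp add: pg_hyperplane_def)
  qed
  have "\<not> Y \<subseteq> ?U"
    using notin vec.span_minimal[OF Union_subset_Q subspace_Q] by blast
  then have V: "pg_hyperplane (vec.span (Y \<union> ?U))"
    using dim_span_Un_point[of ?U Y] Y dim_Union_points[OF A(1)] A(2)
    by (simp add: pg_hyperplane_def)
  have sub: "Y \<subseteq> vec.span (Y \<union> ?U)" "\<Union>A \<subseteq> vec.span (Y \<union> ?U)"
    using vec.span_superset[of "Y \<union> ?U"] vec.span_superset[of "\<Union>A"] by auto
  have "vec.span (Y \<union> ?U) \<noteq> Q A" using notin sub(1) by auto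
  then have "meet_card G (vec.span (Y \<union> ?U)) = CARD('k) - 1 + s"
    by (rule Q_eq_tangent(2)[OF A V sub(2)])
  moreover have "meet_card G (vec.span (Y \<union> ?U)) \<le> CARD('k) - 2 + s"
    by (rule meet_Y[OF V sub(1)])
  ultimately show False using dim_ge_3 by simp
qed

end

section \<open>From intersection numbers to codes\<close>

text \<open>\<open>Max\<close> is well behaved here because the zero subspace extends to a
  hyperplane, so the set of values is nonempty.\<close>

lemma Max_hyperplane_eq_iff:
  fixes f :: "('a::{field,finite} ^ 'k::finite) set \<Rightarrow> nat"
  shows "Max {f H | H. pg_hyperplane H} = m \<longleftrightarrow>
    (\<exists>H. pg_hyperplane H \<and> f H = m) \<and> (\<forall>H. pg_hyperplane H \<longrightarrow> f H \<le> m)"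
proof -
  have "vec.dim ({} :: ('a ^ 'k) set) = 0" by (rule vec.dim_empty)
  then have "vec.dim (vec.span {} :: ('a ^ 'k) set) < CARD('k)" by simp
  then obtain H :: "('a ^ 'k) set" where "pg_hyperplane H"
    using hyperplane_superset vec.subspace_span by metis
  moreover have "{f H | H. pg_hyperplane H} = f ` {H. pg_hyperplane H}" by auto
  ultimately show ?thesis
    by (subst Max_eq_iff) auto
qed

theorem corollary4:
  fixes G :: "('a::{field,finite} ^ 'k::finite) set multiset"
    and q k n d s :: nat
  assumes "q = CARD('a)"
    and "k \<ge> 3"
    and "0 < s" and "int s < int q - 2"
    and "(s + 2) dvd q"
    and "AsMDS s n k d G"
    and "n = (s + 1) * (q + 1) + k - 3"
  shows "\<exists>!X. pg_point X \<and> (\<exists>d'. length_maximal_AsMDS s (n + 1) k d' (add_mset X G))"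
proof -
  \<comment> \<open>Singleton defect \<open>s\<close> fixes the maximum n' - d' at
    \<open>k - 1 + s\<close>, so the definition unfolds without \<open>Max\<close> or
    integers.\<close>
  have AsMDS_iff: "AsMDS s n' k d' G' \<longleftrightarrow> k = CARD('k) \<and> size G' = n' \<and> (\<forall>P\<in>#G'. pg_point P) \<and>
      (\<forall>H. pg_hyperplane H \<longrightarrow> (\<exists>P\<in>#G'. \<not> P \<subseteq> H)) \<and> n' + 1 = k + s + d' \<and>
      (\<exists>H. pg_hyperplane H \<and> meet_card G' H = k - 1 + s) \<and>
      (\<forall>H. pg_hyperplane H \<longrightarrow> meet_card G' H \<le> k - 1 + s)"
    for n' d' and G' :: "('a ^ 'k) set multiset"
  proof -
    have "n' + 1 = k + s + d' \<Longrightarrow> int n' - int d' = int m \<longleftrightarrow> m = k - 1 + s" for m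
      using assms(2) by linarith
    moreover have "int n' - int k + 1 - int d' = int s \<longleftrightarrow> n' + 1 = k + s + d'" by linarith
    ultimately show ?thesis
      unfolding AsMDS_def projective_system_def singleton_defect_def
      using Max_hyperplane_eq_iff[of "meet_card G'" "k - 1 + s"] by blast
  qed
  have G: "k = CARD('k)" "size G = n" "\<forall>P\<in>#G. pg_point P" "n + 1 = k + s + d"
    "\<And>H. pg_hyperplane H \<Longrightarrow> \<exists>P\<in>#G. \<not> P \<subseteq> H"
    "\<And>H. pg_hyperplane H \<Longrightarrow> meet_card G H \<le> k - 1 + s"
    using assms(6) unfolding AsMDS_iff by auto
  obtain H0 where H0: "pg_hyperplane H0" "meet_card G H0 = k - 1 + s"
    using assms(6) unfolding AsMDS_iff by auto
  interpret near_maximal_system G s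
    using assms G by unfold_locales auto
  have meet_add: "meet_card (add_mset X G) H = meet_card G H + (if X \<subseteq> H then 1 else 0)" for X H
    by (simp add: meet_card_def)
  have n: "n + 1 = (s + 1) * (CARD('a) + 1) + k - 2"
    using assms by simp
  show ?thesis
  proof (rule ex1I[of _ "Q {}"])
    \<comment> \<open>A hyperplane attaining the maximum avoids \<open>Q {}\<close>, so its
      intersection number survives the extension.\<close>
    have "\<not> Q {} \<subseteq> H0"
      using meet_card_through_Q_empty[OF H0(1)] H0(2) G(1) assms(2) by auto
    then have "meet_card (add_mset (Q {}) G) H0 = k - 1 + s"
      using H0(2) by (simp add: meet_add)
    moreover have "meet_card (add_mset (Q {}) G) H \<le> k - 1 + s" if "pg_hyperplane H" for H
      using meet_card_through_Q_empty[OF that] G(6)[OF that] G(1) assms(2) by (auto simp: meet_add)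
    \<comment> \<open>The length grows by one while the maximal intersection stays, so the minimum
      distance becomes \<open>d + 1\<close>.\<close>
    ultimately have "AsMDS s (n + 1) k (d + 1) (add_mset (Q {}) G)"
      unfolding AsMDS_iff using G H0(1) pg_point_Q_empty by auto
    then show "pg_point (Q {}) \<and> (\<exists>d'. length_maximal_AsMDS s (n + 1) k d' (add_mset (Q {}) G))"
      using pg_point_Q_empty assms(2) n by (auto simp: length_maximal_AsMDS_def)
  next
    fix Y assume Y: "pg_point Y \<and> (\<exists>d'. length_maximal_AsMDS s (n + 1) k d' (add_mset Y G))"
    then have le: "meet_card (add_mset Y G) H \<le> k - 1 + s" if "pg_hyperplane H" for H
      using that unfolding length_maximal_AsMDS_def AsMDS_iff by blast
    show "Y = Q {}"
    proof (rule extension_point_unique)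
      \<comment> \<open>Adding \<open>Y\<close> raises the count on each hyperplane through it by
        one, so the bound before the addition is one lower.\<close>
      show "meet_card G H \<le> CARD('k) - 2 + s" if "pg_hyperplane H" "Y \<subseteq> H" for H
        using le[OF that(1)] that(2) G(1) assms(2) by (simp add: meet_add)
    qed (use Y in blast)
  qed
qed

end
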